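(* Let $\Omega$ be a slice domain in $\mathbb{H}$, let $f:\Omega\to\mathbb{H}$ be a nonconstant slice regular function, let $D_f\subseteq\Omega\setminus\mathbb{R}$ be its degenerate set and let $\overline{D_f}$ denote the closure of $D_f$ in $\Omega$. Then the restriction $f:\Omega\setminus\overline{D_f}\to\mathbb{H}$ is an open map.
   Context: $\mathbb{H}$ is the real algebra of quaternions, $\mathbb{S}=\{J\in\mathbb{H}:J^2=-1\}$, $L_I=\mathbb{R}+I\mathbb{R}$ and $T_I=T\cap L_I$ for $I\in\mathbb{S}$, $T\subseteq\mathbb{H}$. A domain is a nonempty open connected set; a slice domain is a domain $\Omega\subseteq\mathbb{H}$ with $\Omega\cap\mathbb{R}\neq\emptyset$ such that $\Omega_I$ is a domain of $L_I$ for every $I\in\mathbb{S}$. A function $f:\Omega\to\mathbb{H}$ is slice regular if, for every $I\in\mathbb{S}$, the restriction $f_I$ of $f$ to $\Omega_I$ has continuous partial derivatives and $\frac12\left(\frac{\partial}{\partial x}+I\frac{\partial}{\partial y}\right)f_I(x+yI)\equiv0$. Spherical derivative: for a slice regular $f$ on a slice domain $\Omega$ and $p_0=x_0+y_0I_0\in\Omega\setminus\mathbb{R}$ ($y_0>0$, $I_0\in\mathbb{S}$), it is known that there exist a neighborhood $U\subseteq\Omega$ of $p_0$ in $x_0+y_0\mathbb{S}=\{x_0+y_0J:J\in\mathbb{S}\}$ and unique quaternions $b(p_0),c(p_0)$ (independent of $U$) with $f(x_0+y_0I)=b(p_0)+I\,c(p_0)$ for all $x_0+y_0I\in U$. The spherical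 derivative is $f'_s:\Omega\setminus\mathbb{R}\to\mathbb{H}$, $f'_s(p_0)=y_0^{-1}c(p_0)$. The degenerate set $D_f$ of $f$ is the zero set of $f'_s$. *)

theory Defs
  imports "HOL-Analysis.Analysis"
begin

datatype quat = Quat (qre: real) (qim1: real) (qim2: real) (qim3: real)

lemma quat_eq_iff:
  "p = q \<longleftrightarrow> qre p = qre q \<and> qim1 p = qim1 q \<and> qim2 p = qim2 q \<and> qim3 p = qim3 q"
  by (cases p; cases q) simp

instantiation quat :: ab_group_add
begin

definition zero_quat :: quat where "0 = Quat 0 0 0 0"

definition plus_quat :: "quat \<Rightarrow> quat \<Rightarrow> quat" where
  "p + q = Quat (qre p + qre q) (qim1 p + qim1 q) (qim2 p + qim2 q) (qim3 p + qim3 q)"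

definition uminus_quat :: "quat \<Rightarrow> quat" where
  "- p = Quat (- qre p) (- qim1 p) (- qim2 p) (- qim3 p)"

definition minus_quat :: "quat \<Rightarrow> quat \<Rightarrow> quat" where
  "p - q = Quat (qre p - qre q) (qim1 p - qim1 q) (qim2 p - qim2 q) (qim3 p - qim3 q)"

instance
  by standard (simp_all add: zero_quat_def plus_quat_def uminus_quat_def minus_quat_def)

end

instantiation quat :: ring_1
begin

definition one_quat :: quat where "1 = Quat 1 0 0 0"

definition times_quat :: "quat \<Rightarrow> quat \<Rightarrow> quat" where
  "p * q = Quat
     (qre p * qre q - qim1 p * qim1 q - qim2 p * qim2 q - qim3 p * qim3 q)
     (qre p * qim1 q + qim1 p * qre q + qim2 p * qim3 q - qim3 p * qim2 q)
     (qre p * qim2 q - qim1 p * qim3 q + qim2 p * qre q + qim3 p * qim1 q)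
     (qre p * qim3 q + qim1 p * qim2 q - qim2 p * qim1 q + qim3 p * qre q)"

instance
  by standard
    (simp_all add: zero_quat_def one_quat_def plus_quat_def times_quat_def algebra_simps)

end

instantiation quat :: real_algebra_1
begin

definition scaleR_quat :: "real \<Rightarrow> quat \<Rightarrow> quat" where
  "r *\<^sub>R q = Quat (r * qre q) (r * qim1 q) (r * qim2 q) (r * qim3 q)"

instance
  by standard
    (simp_all add: plus_quat_def times_quat_def scaleR_quat_def algebra_simps)

end

instantiation quat :: real_inner
begin

definition inner_quat :: "quat \<Rightarrow> quat \<Rightarrow> real" where
  "p \<bullet> q = qre p * qre q + qim1 p * qim1 q + qim2 p * qim2 q + qim3 p * qim3 q"

definition norm_quat :: "quat \<Rightarrow> real" where
  "norm (q :: quat) = sqrt ((qre q)\<^sup>2 + (qim1 q)\<^sup>2 + (qim2 q)\<^sup>2 + (qim3 q)\<^sup>2)"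

definition sgn_quat :: "quat \<Rightarrow> quat" where
  "sgn (q :: quat) = q /\<^sub>R norm q"

definition dist_quat :: "quat \<Rightarrow> quat \<Rightarrow> real" where
  "dist (p :: quat) q = norm (p - q)"

definition uniformity_quat :: "(quat \<times> quat) filter" where
  "(uniformity :: (quat \<times> quat) filter) = (INF e\<in>{0 <..}. principal {(p :: quat, q). dist p q < e})"

definition open_quat :: "quat set \<Rightarrow> bool" where
  "open (U :: quat set) \<longleftrightarrow> (\<forall>p\<in>U. eventually (\<lambda>(p', q). p' = p \<longrightarrow> q \<in> U) uniformity)"

instance
proof
  fix p q r :: quat and a :: real
  show "p \<bullet> q = q \<bullet> p" by (simp add: inner_quat_def mult.commute)
  show "(p + q) \<bullet> r = p \<bullet> r + q \<bullet> r"
    by (simp add: inner_quat_def plus_quat_def algebra_simps)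
  show "(a *\<^sub>R p) \<bullet> q = a * (p \<bullet> q)"
    by (simp add: inner_quat_def scaleR_quat_def algebra_simps)
  show "0 \<le> p \<bullet> p" by (simp add: inner_quat_def)
  show "p \<bullet> p = 0 \<longleftrightarrow> p = 0"
    by (auto simp: inner_quat_def quat_eq_iff zero_quat_def add_nonneg_eq_0_iff)
  show "norm p = sqrt (p \<bullet> p)"
    by (simp add: inner_quat_def norm_quat_def power2_eq_square)
qed (simp_all add: sgn_quat_def dist_quat_def uniformity_quat_def open_quat_def)

end

instantiation quat :: real_normed_div_algebra
begin

definition inverse_quat :: "quat \<Rightarrow> quat" where
  "inverse (q :: quat) = Quat (qre q) (- qim1 q) (- qim2 q) (- qim3 q) /\<^sub>R (norm q)\<^sup>2"

definition divide_quat :: "quat \<Rightarrow> quat \<Rightarrow> quat" where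
  "(p :: quat) div q = p * inverse q"

instance
proof
  fix p q :: quat
  have n: "(norm q)\<^sup>2 = (qre q)\<^sup>2 + (qim1 q)\<^sup>2 + (qim2 q)\<^sup>2 + (qim3 q)\<^sup>2" for q :: quat
    by (simp add: norm_quat_def)
  show "inverse q * q = 1" if "q \<noteq> 0"
  proof -
    have "Quat (qre q) (- qim1 q) (- qim2 q) (- qim3 q) * q = (norm q)\<^sup>2 *\<^sub>R 1"
      unfolding n
      by (simp add: times_quat_def one_quat_def scaleR_quat_def power2_eq_square algebra_simps)
    with that show ?thesis by (simp add: inverse_quat_def)
  qed
  show "q * inverse q = 1" if "q \<noteq> 0"
  proof -
    have "q * Quat (qre q) (- qim1 q) (- qim2 q) (- qim3 q) = (norm q)\<^sup>2 *\<^sub>R 1"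
      unfolding n
      by (simp add: times_quat_def one_quat_def scaleR_quat_def power2_eq_square algebra_simps)
    with that show ?thesis by (simp add: inverse_quat_def)
  qed
  have "(norm (p * q))\<^sup>2 = (norm p * norm q)\<^sup>2"
    by (simp add: n power_mult_distrib times_quat_def)
      (simp add: power2_eq_square algebra_simps)
  then show "norm (p * q) = norm p * norm q" by simp
  show "inverse 0 = (0 :: quat)"
    by (simp add: inverse_quat_def zero_quat_def scaleR_quat_def)
qed (simp add: divide_quat_def)

end

instantiation quat :: euclidean_space
begin

definition Basis_quat :: "quat set" where
  "Basis = {Quat 1 0 0 0, Quat 0 1 0 0, Quat 0 0 1 0, Quat 0 0 0 1}"

instance
proof
  show "(Basis :: quat set) \<noteq> {}" "finite (Basis :: quat set)"
    by (simp_all add: Basis_quat_def)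
  show "u \<bullet> v = (if u = v then 1 else 0)" if "u \<in> Basis" "v \<in> Basis" for u v :: quat
    using that unfolding Basis_quat_def by (elim insertE emptyE) (simp_all add: inner_quat_def)
  show "(\<forall>u\<in>Basis. p \<bullet> u = 0) \<longleftrightarrow> p = 0" for p :: quat
    unfolding Basis_quat_def by (cases p) (simp add: inner_quat_def zero_quat_def)
qed

end

definition imag_units :: "quat set" where
  "imag_units = {J. J\<^sup>2 = - 1}"

definition slice :: "quat \<Rightarrow> quat set" where
  "slice I = {of_real x + y *\<^sub>R I | x y. True}"

definition slice_domain :: "quat set \<Rightarrow> bool" where
  "slice_domain \<Omega> \<longleftrightarrow>
     \<Omega> \<noteq> {} \<and> open \<Omega> \<and> connected \<Omega> \<and> \<Omega> \<inter> \<real> \<noteq> {} \<and>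
     (\<forall>I\<in>imag_units.
        \<Omega> \<inter> slice I \<noteq> {} \<and>
        openin (top_of_set (slice I)) (\<Omega> \<inter> slice I) \<and>
        connected (\<Omega> \<inter> slice I))"

text \<open>
  The functions \<open>fx\<close> and \<open>fy\<close> are the two partial derivatives of
  \<open>(x, y) \<mapsto> f (x + y I)\<close>, and \<open>P\<close> is \<open>\<Omega> \<inter> slice I\<close> in the coordinates \<open>(x, y)\<close>.
  For open \<open>\<Omega>\<close> only the values of \<open>f\<close> on \<open>\<Omega>\<close> matter.
\<close>

definition slice_regular_on :: "quat set \<Rightarrow> (quat \<Rightarrow> quat) \<Rightarrow> bool" where
  "slice_regular_on \<Omega> f \<longleftrightarrow>
     (\<forall>I\<in>imag_units. \<exists>fx fy :: real \<times> real \<Rightarrow> quat.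
        let P = {(x, y). of_real x + y *\<^sub>R I \<in> \<Omega>} in
        continuous_on P fx \<and> continuous_on P fy \<and>
        (\<forall>(x, y)\<in>P.
           ((\<lambda>t. f (of_real t + y *\<^sub>R I)) has_vector_derivative fx (x, y)) (at x) \<and>
           ((\<lambda>t. f (of_real x + t *\<^sub>R I)) has_vector_derivative fy (x, y)) (at y) \<and>
           (1 / 2) *\<^sub>R (fx (x, y) + I * fy (x, y)) = 0))"

definition sphere_through :: "real \<Rightarrow> real \<Rightarrow> quat set" where
  "sphere_through x y = {of_real x + y *\<^sub>R J | J. J \<in> imag_units}"

text \<open>
  \<open>spherical_coeffs \<Omega> f x y I b c\<close>: near \<open>x + y I\<close> on its sphere, \<open>f (x + y J) = b + J c\<close>.
\<close>

definition spherical_coeffs ::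
  "quat set \<Rightarrow> (quat \<Rightarrow> quat) \<Rightarrow> real \<Rightarrow> real \<Rightarrow> quat \<Rightarrow> quat \<Rightarrow> quat \<Rightarrow> bool" where
  "spherical_coeffs \<Omega> f x y I b c \<longleftrightarrow>
     (\<exists>U. openin (top_of_set (sphere_through x y)) U \<and> of_real x + y *\<^sub>R I \<in> U \<and> U \<subseteq> \<Omega> \<and>
        (\<forall>J\<in>imag_units. of_real x + y *\<^sub>R J \<in> U \<longrightarrow> f (of_real x + y *\<^sub>R J) = b + J * c))"

text \<open>
  Every non-real \<open>p\<close> is \<open>x + y I\<close> for exactly one \<open>x\<close>, \<open>y > 0\<close> and imaginary unit \<open>I\<close>. If \<open>f\<close> is
  slice regular on a slice domain \<open>\<Omega>\<close> and \<open>p \<in> \<Omega>\<close>, then \<open>b\<close> and \<open>c\<close> exist and are unique as well;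
  otherwise the value is unspecified.
\<close>

definition spherical_deriv :: "quat set \<Rightarrow> (quat \<Rightarrow> quat) \<Rightarrow> quat \<Rightarrow> quat" where
  "spherical_deriv \<Omega> f p =
     (THE d. \<exists>x y I b c. y > 0 \<and> I \<in> imag_units \<and> p = of_real x + y *\<^sub>R I \<and>
        spherical_coeffs \<Omega> f x y I b c \<and> d = c /\<^sub>R y)"

definition degenerate_set :: "quat set \<Rightarrow> (quat \<Rightarrow> quat) \<Rightarrow> quat set" where
  "degenerate_set \<Omega> f = {p \<in> \<Omega> - \<real>. spherical_deriv \<Omega> f p = 0}"

end

theory Submission
  imports Defs "HOL-Complex_Analysis.Complex_Analysis"
begin

text \<open>
  Near every point of \<open>\<Omega>\<close> the function has the form \<open>f (x + y I) = b (x, y) + I c (x, y)\<close>, where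
  \<open>b\<close> and \<open>c\<close> satisfy the Cauchy-Riemann equations, so that \<open>b + \<i> c\<close> is a holomorphic function with
  values in the complexified quaternions (\<open>representation_formula\<close>). The formula holds on a connected
  open set \<open>N\<close> of complex coordinates that meets the real axis (\<open>slice_domain_tube\<close>); on the real axis
  \<open>c = 0\<close> and \<open>f = b\<close>. The spherical derivative at \<open>x + y I\<close> vanishes iff \<open>c (x, y)\<close> does
  (\<open>degenerate_set_iff\<close>).

  For \<open>c \<noteq> 0\<close> the equation \<open>b + I c = w\<close> has an imaginary unit \<open>I\<close> as solution iff \<open>b - w\<close> is
  orthogonal to \<open>c\<close> and of the same norm, that is, iff the complex number
  \<open>\<phi>\<^sub>w = \<bar>b - w\<bar>\<^sup>2 - \<bar>c\<bar>\<^sup>2 + 2 \<i> (b - w) \<bullet> c\<close> vanishes; the solution is then \<open>(w - b) c\<^sup>-\<^sup>1\<close>. As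
  a function of \<open>z = x + \<i> y\<close>, \<open>\<phi>\<^sub>w\<close> is holomorphic. If \<open>w\<^sub>0 = f p\<close>, then \<open>\<phi>\<close> for \<open>w\<^sub>0\<close> has a zero at
  the coordinate \<open>z\<^sub>0\<close> of \<open>p\<close>, and it is not identically zero: otherwise \<open>f = w\<^sub>0\<close> on a real interval
  and hence on all of \<open>\<Omega>\<close> (\<open>sphere_norm_not_identically_0\<close>). By the argument of Hurwitz' theorem, \<open>\<phi>\<^sub>w\<close>
  has a zero near \<open>z\<^sub>0\<close> for every \<open>w\<close> near \<open>w\<^sub>0\<close> (\<open>sphere_norm_zero_persists\<close>). Off the closure of the
  degenerate set \<open>c\<close> does not vanish at the non-real points, so this zero yields a point near \<open>p\<close> at
  which \<open>f\<close> takes the value \<open>w\<close>; if the zero is real, then \<open>f = b = w\<close> there.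
\<close>

section \<open>Imaginary units and slices\<close>

lemma imag_units_iff:
  "I \<in> imag_units \<longleftrightarrow> qre I = 0 \<and> (qim1 I)\<^sup>2 + (qim2 I)\<^sup>2 + (qim3 I)\<^sup>2 = 1"
proof
  assume "I \<in> imag_units"
  then have "I * I = - 1" by (simp add: imag_units_def power2_eq_square)
  then have e: "qre I * qre I - qim1 I * qim1 I - qim2 I * qim2 I - qim3 I * qim3 I = - 1"
    "qre I * qim1 I = 0" "qre I * qim2 I = 0" "qre I * qim3 I = 0"
    by (auto simp: quat_eq_iff times_quat_def uminus_quat_def one_quat_def)
  have "qre I = 0"
  proof (rule ccontr)
    assume "qre I \<noteq> 0"
    then have "qim1 I = 0" "qim2 I = 0" "qim3 I = 0" using e by auto
    then have "qre I * qre I = - 1" using e by simp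
    then show False by (metis not_one_le_zero neg_0_le_iff_le zero_le_square)
  qed
  then show "qre I = 0 \<and> (qim1 I)\<^sup>2 + (qim2 I)\<^sup>2 + (qim3 I)\<^sup>2 = 1"
    using e by (simp add: power2_eq_square)
next
  assume "qre I = 0 \<and> (qim1 I)\<^sup>2 + (qim2 I)\<^sup>2 + (qim3 I)\<^sup>2 = 1"
  then show "I \<in> imag_units"
    by (auto simp: imag_units_def power2_eq_square quat_eq_iff times_quat_def uminus_quat_def
        one_quat_def)
qed

lemma imag_units_square: "I \<in> imag_units \<Longrightarrow> I * I = - 1"
  by (simp add: imag_units_def power2_eq_square)

lemma imag_units_square': "I \<in> imag_units \<Longrightarrow> I * (I * q) = - q"
  by (simp add: imag_units_square flip: mult.assoc)

lemma uminus_imag_units: "I \<in> imag_units \<Longrightarrow> - I \<in> imag_units"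
  by (simp add: imag_units_def)

lemma inner_mult_right_quat: "(u * q) \<bullet> q = qre u * (q \<bullet> q)"
  by (simp add: inner_quat_def times_quat_def algebra_simps)

lemma qre_of_real: "qre (of_real x) = x"
  by (simp add: of_real_def scaleR_quat_def one_quat_def)

lemma inner_imag_unit_left:
  assumes "I \<in> imag_units"
  shows "(I * p) \<bullet> q = - (p \<bullet> (I * q))"
  using assms by (simp add: imag_units_iff inner_quat_def times_quat_def algebra_simps)

text \<open>The point \<open>x + y I\<close> of the slice of \<open>I\<close> with complex coordinate \<open>z = x + \<i> y\<close>.\<close>

definition slice_point :: "quat \<Rightarrow> complex \<Rightarrow> quat" where
  "slice_point I z = of_real (Re z) + Im z *\<^sub>R I"

lemma continuous_on_slice_point [continuous_intros]:
  fixes g :: "'a::topological_space \<Rightarrow> quat"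
  assumes "continuous_on S g" "continuous_on S h"
  shows "continuous_on S (\<lambda>x. slice_point (g x) (h x))"
  unfolding slice_point_def of_real_def by (intro continuous_intros assms)

lemma slice_point_of_real [simp]: "slice_point I (of_real x) = of_real x"
  by (simp add: slice_point_def)

lemma slice_point_diff: "slice_point I (z - w) = slice_point I z - slice_point I w"
  by (simp add: slice_point_def algebra_simps)

lemma slice_point_eq_real: "Im z = 0 \<Longrightarrow> slice_point I z = of_real (Re z)"
  by (simp add: slice_point_def)

lemma slice_point_minus: "slice_point (- I) z = slice_point I (cnj z)"
  by (simp add: slice_point_def)

lemma norm_slice_point:
  assumes "I \<in> imag_units"
  shows "norm (slice_point I z) = cmod z"
proof -
  have re: "qre I = 0" using assms by (simp add: imag_units_iff)
  have "(norm (slice_point I z))\<^sup>2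
      = (Re z)\<^sup>2 + (Im z)\<^sup>2 * ((qim1 I)\<^sup>2 + (qim2 I)\<^sup>2 + (qim3 I)\<^sup>2)"
    using re
    by (simp add: slice_point_def norm_quat_def of_real_def scaleR_quat_def one_quat_def
        plus_quat_def power_mult_distrib algebra_simps)
  also have "(qim1 I)\<^sup>2 + (qim2 I)\<^sup>2 + (qim3 I)\<^sup>2 = 1"
    using assms by (simp add: imag_units_iff)
  also have "(Re z)\<^sup>2 + (Im z)\<^sup>2 * 1 = (cmod z)\<^sup>2"
    by (simp add: cmod_power2)
  finally show ?thesis by simp
qed

lemma slice_point_inject:
  assumes "I \<in> imag_units" "slice_point I z = slice_point I w"
  shows "z = w"
  using norm_slice_point[OF assms(1), of "z - w"] assms(2) by (simp add: slice_point_diff)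

lemma imag_units_slice_point_unique:
  assumes "I \<in> imag_units" "J \<in> imag_units" "slice_point I z = slice_point J w"
    and "Im z > 0" "Im w > 0"
  shows "z = w \<and> I = J"
proof -
  have re: "qre (slice_point I z) = Re z" "qre (slice_point J w) = Re w"
    using assms
    by (simp_all add: slice_point_def plus_quat_def qre_of_real scaleR_quat_def imag_units_iff)
  then have 1: "Re z = Re w" using assms(3) by simp
  have "cmod z = cmod w" using norm_slice_point assms(1-3) by metis
  then have "(Im z)\<^sup>2 = (Im w)\<^sup>2" using 1 by (simp add: cmod_def)
  then have 2: "Im z = Im w" using assms(4,5) by (metis less_imp_le power2_eq_iff_nonneg)
  then have "Im z *\<^sub>R I = Im z *\<^sub>R J" using assms(3) 1 by (simp add: slice_point_def)
  then show ?thesis using 1 2 assms(4) by (simp add: complex_eq_iff)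
qed

lemma imag_units_nonempty: "imag_units \<noteq> {}"
proof -
  have "Quat 0 1 0 0 \<in> imag_units" by (simp add: imag_units_iff)
  then show ?thesis by blast
qed

lemma quat_slice_point_cases:
  obtains I z where "I \<in> imag_units" "q = slice_point I z"
proof -
  define r where "r = sqrt ((qim1 q)\<^sup>2 + (qim2 q)\<^sup>2 + (qim3 q)\<^sup>2)"
  show ?thesis
  proof (cases "r = 0")
    case True
    then have "(qim1 q)\<^sup>2 + (qim2 q)\<^sup>2 + (qim3 q)\<^sup>2 = 0" by (simp add: r_def)
    then have "qim1 q = 0" "qim2 q = 0" "qim3 q = 0"
      by (simp_all add: add_nonneg_eq_0_iff)
    then have "q = of_real (qre q)"
      by (simp add: quat_eq_iff of_real_def scaleR_quat_def one_quat_def)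
    then show ?thesis using imag_units_nonempty that[of _ "of_real (qre q)"] by auto
  next
    case False
    have r2: "r\<^sup>2 = (qim1 q)\<^sup>2 + (qim2 q)\<^sup>2 + (qim3 q)\<^sup>2" by (simp add: r_def)
    define I where "I = Quat 0 (qim1 q / r) (qim2 q / r) (qim3 q / r)"
    have "I \<in> imag_units"
      using False by (simp add: I_def imag_units_iff power_divide r2[symmetric] flip: add_divide_distrib)
    moreover have "q = slice_point I (Complex (qre q) r)"
      using False
      by (simp add: I_def slice_point_def quat_eq_iff of_real_def scaleR_quat_def one_quat_def
          plus_quat_def)
    ultimately show ?thesis using that by blast
  qed
qed

lemma slice_point_in_Reals_iff:
  assumes "I \<in> imag_units"
  shows "slice_point I z \<in> \<real> \<longleftrightarrow> Im z = 0"
proof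
  assume "slice_point I z \<in> \<real>"
  then obtain x where x: "slice_point I z = of_real x" by (auto elim: Reals_cases)
  then have "slice_point I z = slice_point I (of_real x)" by simp
  then have "z = of_real x" using slice_point_inject[OF assms] by blast
  then show "Im z = 0" by simp
qed (simp add: slice_point_eq_real)

text \<open>The sphere of imaginary units has no isolated points: conjugating \<open>I\<close> by \<open>1 + t L\<close> with
  small \<open>t > 0\<close> moves it whenever \<open>L\<close> does not commute with \<open>I\<close>.\<close>

lemma imag_units_no_isolated:
  assumes I: "I \<in> imag_units" and V: "open V" "I \<in> V"
  obtains J where "J \<in> imag_units" "J \<in> V" "J \<noteq> I"
proof -
  obtain L where L: "L * I \<noteq> I * L"
  proof (cases "qim2 I = 0 \<and> qim3 I = 0")
    case True
    then have "qim1 I \<noteq> 0" using I by (auto simp: imag_units_iff)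
    then have "Quat 0 0 1 0 * I \<noteq> I * Quat 0 0 1 0"
      by (auto simp: quat_eq_iff times_quat_def)
    then show ?thesis using that by blast
  next
    case False
    then have "Quat 0 1 0 0 * I \<noteq> I * Quat 0 1 0 0"
      by (auto simp: quat_eq_iff times_quat_def)
    then show ?thesis using that by blast
  qed
  have lim1: "((\<lambda>t::real. 1 + t *\<^sub>R L) \<longlongrightarrow> 1 + 0 *\<^sub>R L) (at_right 0)"
    by (intro tendsto_intros)
  have lim: "((\<lambda>t::real. (1 + t *\<^sub>R L) * I * inverse (1 + t *\<^sub>R L)) \<longlongrightarrow>
      (1 + 0 *\<^sub>R L) * I * inverse (1 + 0 *\<^sub>R L)) (at_right 0)"
    by (intro tendsto_intros) simp
  then have "\<forall>\<^sub>F t in at_right 0. (1 + t *\<^sub>R L) * I * inverse (1 + t *\<^sub>R L) \<in> V"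
    by (rule topological_tendstoD) (use V in auto)
  moreover have "\<forall>\<^sub>F t in at_right 0. 1 + t *\<^sub>R L \<in> - {0}"
    using lim1 by (rule topological_tendstoD) auto
  moreover have "\<forall>\<^sub>F t in at_right (0::real). t > 0" by (simp add: eventually_at_right_less)
  ultimately have "\<forall>\<^sub>F t in at_right 0. (1 + t *\<^sub>R L) * I * inverse (1 + t *\<^sub>R L) \<in> V
      \<and> 1 + t *\<^sub>R L \<in> - {0} \<and> t > 0"
    by (intro eventually_conj)
  then obtain t :: real where t: "t > 0" "1 + t *\<^sub>R L \<noteq> 0"
      "(1 + t *\<^sub>R L) * I * inverse (1 + t *\<^sub>R L) \<in> V"
    using eventually_happens[of _ "at_right (0::real)"] by (auto simp: trivial_limit_at_right_real)
  define u where "u = 1 + t *\<^sub>R L"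
  have u: "u \<noteq> 0" using t by (simp add: u_def)
  define J where "J = u * I * inverse u"
  have "J * J = u * I * (inverse u * u) * (I * inverse u)"
    unfolding J_def by (simp only: mult.assoc)
  also have "\<dots> = u * (I * I) * inverse u" using u by (simp add: mult.assoc)
  also have "\<dots> = - 1" using u by (simp add: imag_units_square[OF I])
  finally have "J \<in> imag_units" by (simp add: imag_units_def power2_eq_square)
  moreover have "J \<noteq> I"
  proof
    assume "J = I"
    then have "u * I = I * u" using u by (metis J_def mult.assoc left_inverse mult.right_neutral)
    then have "t *\<^sub>R (L * I) = t *\<^sub>R (I * L)" by (simp add: u_def algebra_simps)
    then show False using L t by simp
  qed
  ultimately show ?thesis using that t by (simp add: J_def u_def)
qed

section \<open>Holomorphy along a slice and the identity principle\<close>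

text \<open>Left \<open>I\<close>-holomorphy of a quaternion-valued function of a complex variable: its real
  derivative is \<open>h \<mapsto> (Re h + Im h I) D\<close>. This is the equation
  \<open>(\<partial>/\<partial>x + I \<partial>/\<partial>y) g = 0\<close> together with real differentiability.\<close>

definition slice_holomorphic_on :: "quat \<Rightarrow> complex set \<Rightarrow> (complex \<Rightarrow> quat) \<Rightarrow> bool" where
  "slice_holomorphic_on I N g \<longleftrightarrow>
     (\<forall>z\<in>N. \<exists>D. (g has_derivative (\<lambda>h. slice_point I h * D)) (at z))"

lemma slice_holomorphic_on_subset:
  "slice_holomorphic_on I N g \<Longrightarrow> M \<subseteq> N \<Longrightarrow> slice_holomorphic_on I M g"
  by (auto simp: slice_holomorphic_on_def)

lemma slice_holomorphic_on_diff:
  assumes "slice_holomorphic_on I N g" "slice_holomorphic_on I N h"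
  shows "slice_holomorphic_on I N (\<lambda>z. g z - h z)"
  unfolding slice_holomorphic_on_def
proof
  fix z assume "z \<in> N"
  then obtain D E where "(g has_derivative (\<lambda>h. slice_point I h * D)) (at z)"
    "(h has_derivative (\<lambda>h. slice_point I h * E)) (at z)"
    using assms unfolding slice_holomorphic_on_def by meson
  then have "((\<lambda>z. g z - h z) has_derivative (\<lambda>h. slice_point I h * D - slice_point I h * E)) (at z)"
    by (rule has_derivative_diff)
  then show "\<exists>D. ((\<lambda>z. g z - h z) has_derivative (\<lambda>h. slice_point I h * D)) (at z)"
    by (auto simp flip: right_diff_distrib)
qed

lemma slice_holomorphic_on_const: "slice_holomorphic_on I N (\<lambda>_. q)"
  unfolding slice_holomorphic_on_def by (auto intro!: exI[of _ 0])

lemma real_islimpt_open: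
  assumes "open N" "complex_of_real r \<in> N"
  shows "complex_of_real r islimpt (N \<inter> \<real>)"
  unfolding islimpt_approachable
proof (intro allI impI)
  fix e :: real assume e: "e > 0"
  obtain d where d: "d > 0" "ball (complex_of_real r) d \<subseteq> N"
    using assms open_contains_ball by blast
  define x where "x = r + min d e / 2"
  have "dist (complex_of_real x) (of_real r) = min d e / 2"
    using d e by (simp add: x_def dist_norm flip: of_real_diff)
  moreover have "x \<noteq> r" using d e by (simp add: x_def)
  ultimately show "\<exists>x'\<in>N \<inter> \<real>. x' \<noteq> complex_of_real r \<and> dist x' (complex_of_real r) < e"
    using d e by (intro bexI[of _ "complex_of_real x"]) (auto simp: dist_commute subset_iff)
qed

text \<open>The real functionals \<open>q \<mapsto> q \<bullet> v\<close> are the real parts of the maps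
  \<open>q \<mapsto> q \<bullet> v + \<i> (q \<bullet> (I v))\<close>, which turn left multiplication by \<open>I\<close> into multiplication by
  \<open>\<i>\<close>; composing with these reduces the identity principle to the one for holomorphic functions.\<close>

lemma slice_holomorphic_identity:
  assumes I: "I \<in> imag_units"
    and g: "slice_holomorphic_on I N g"
    and N: "open N" "connected N" "complex_of_real r \<in> N"
    and U: "open U" "complex_of_real r \<in> U"
    and zero: "\<And>x. complex_of_real x \<in> N \<inter> U \<Longrightarrow> g (of_real x) = 0"
    and z: "z \<in> N"
  shows "g z = 0"
proof -
  have "g z \<bullet> v = 0" for v
  proof -
    define \<phi> where "\<phi> q = Complex (q \<bullet> v) (q \<bullet> (I * v))" for q
    have \<phi>_eq: "\<phi> = (\<lambda>q. of_real (q \<bullet> v) + \<i> * of_real (q \<bullet> (I * v)))"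
      by (auto simp: \<phi>_def complex_eq_iff fun_eq_iff)
    have lin: "bounded_linear \<phi>"
      unfolding \<phi>_eq
      by (intro bounded_linear_add bounded_linear_const_mult
          bounded_linear_of_real[THEN bounded_linear_compose] bounded_linear_inner_left)
    have I': "(I * q) \<bullet> (I * v) = q \<bullet> v" for q
      using inner_imag_unit_left[OF I, of q "I * v"] by (simp add: imag_units_square'[OF I])
    have mult: "\<phi> (slice_point I h * q) = h * \<phi> q" for h q
      by (simp add: \<phi>_def complex_eq_iff slice_point_def distrib_right inner_add_left
          inner_imag_unit_left[OF I, of q v] I' of_real_def)
    have "(\<phi> \<circ> g) holomorphic_on N"
      unfolding holomorphic_on_def
    proof
      fix w assume "w \<in> N"
      then obtain D where "(g has_derivative (\<lambda>h. slice_point I h * D)) (at w)"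
        using g by (auto simp: slice_holomorphic_on_def)
      then have "((\<lambda>w. \<phi> (g w)) has_derivative (\<lambda>h. \<phi> (slice_point I h * D))) (at w)"
        by (rule bounded_linear.has_derivative[OF lin])
      moreover have "(\<lambda>h. \<phi> (slice_point I h * D)) = (*) (\<phi> D)"
        by (simp add: mult fun_eq_iff mult.commute)
      ultimately have "(\<phi> \<circ> g has_field_derivative \<phi> D) (at w)"
        by (simp add: has_field_derivative_def o_def)
      then show "(\<phi> \<circ> g) field_differentiable (at w within N)"
        by (meson field_differentiable_at_within field_differentiable_def)
    qed
    then have "(\<phi> \<circ> g) z = 0"
    proof (rule analytic_continuation)
      show "complex_of_real r islimpt (N \<inter> U \<inter> \<real>)"
        using N U by (intro real_islimpt_open) auto
      show "(\<phi> \<circ> g) w = 0" if "w \<in> N \<inter> U \<inter> \<real>" for w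
        using that zero by (auto elim!: Reals_cases simp: linear_0[OF bounded_linear.linear[OF lin]])
    qed (use N z in auto)
    then show ?thesis by (simp add: \<phi>_def complex_eq_iff)
  qed
  then show ?thesis using inner_eq_zero_iff by blast
qed

lemma open_slice_coordinates:
  assumes "open \<Omega>"
  shows "open {z. slice_point I z \<in> \<Omega>}"
proof -
  have "continuous_on UNIV (slice_point I)" by (intro continuous_intros)
  then show ?thesis using open_vimage[OF assms] by (simp add: vimage_def)
qed

lemma connected_slice_coordinates:
  assumes "I \<in> imag_units" "connected (\<Omega> \<inter> slice I)"
  shows "connected {z. slice_point I z \<in> \<Omega>}"
proof -
  define \<pi> where "\<pi> q = of_real (q \<bullet> 1) + \<i> * of_real (q \<bullet> I)" for q
  have \<pi>: "\<pi> (slice_point I z) = z" for z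
    using assms(1)
    by (simp add: \<pi>_def slice_point_def complex_eq_iff inner_quat_def plus_quat_def of_real_def
        scaleR_quat_def one_quat_def imag_units_iff power2_eq_square mult.assoc
        flip: distrib_left)
  have "{z. slice_point I z \<in> \<Omega>} = \<pi> ` (\<Omega> \<inter> slice I)"
  proof (intro equalityI subsetI)
    fix z assume z: "z \<in> {z. slice_point I z \<in> \<Omega>}"
    then have "slice_point I z \<in> \<Omega> \<inter> slice I" by (auto simp: slice_def slice_point_def)
    then show "z \<in> \<pi> ` (\<Omega> \<inter> slice I)" using \<pi>[of z] by (metis imageI)
  next
    fix z assume "z \<in> \<pi> ` (\<Omega> \<inter> slice I)"
    then obtain x y where "of_real x + y *\<^sub>R I \<in> \<Omega>" "z = \<pi> (of_real x + y *\<^sub>R I)"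
      by (auto simp: slice_def)
    then show "z \<in> {z. slice_point I z \<in> \<Omega>}"
      using \<pi>[of "Complex x y"] by (simp add: slice_point_def)
  qed
  moreover have "continuous_on (\<Omega> \<inter> slice I) \<pi>"
    unfolding \<pi>_def by (intro continuous_intros)
  ultimately show ?thesis using assms(2) by (simp add: connected_continuous_image)
qed

text \<open>Continuity of the partial derivatives enters here: it makes the restriction to a slice totally
  differentiable.\<close>

lemma slice_regular_imp_slice_holomorphic:
  assumes f: "slice_regular_on \<Omega> f" and I: "I \<in> imag_units" and \<Omega>: "open \<Omega>"
  shows "slice_holomorphic_on I {z. slice_point I z \<in> \<Omega>} (\<lambda>z. f (slice_point I z))"
  unfolding slice_holomorphic_on_def
proof
  fix z assume z: "z \<in> {z. slice_point I z \<in> \<Omega>}"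
  define P where "P = {(x, y). of_real x + y *\<^sub>R I \<in> \<Omega>}"
  obtain fx fy :: "real \<times> real \<Rightarrow> quat" where
    fyc: "continuous_on P fy"
    and d: "\<And>x y. (x, y) \<in> P \<Longrightarrow>
       ((\<lambda>t. f (of_real t + y *\<^sub>R I)) has_vector_derivative fx (x, y)) (at x) \<and>
       ((\<lambda>t. f (of_real x + t *\<^sub>R I)) has_vector_derivative fy (x, y)) (at y) \<and>
       (1 / 2) *\<^sub>R (fx (x, y) + I * fy (x, y)) = 0"
    using f I unfolding slice_regular_on_def Let_def P_def by fastforce
  define x y where "x = Re z" and "y = Im z"
  have xyP: "(x, y) \<in> P" using z by (simp add: P_def x_def y_def slice_point_def)
  have "P = (\<lambda>p. of_real (fst p) + snd p *\<^sub>R I) -` \<Omega>" by (auto simp: P_def)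
  moreover have "continuous_on UNIV (\<lambda>p. of_real (fst p) + snd p *\<^sub>R I :: quat)"
    by (intro continuous_intros)
  ultimately have "open P" using open_vimage[OF \<Omega>] by simp
  then obtain A B where AB: "open A" "open B" "x \<in> A" "y \<in> B" "A \<times> B \<subseteq> P"
    using xyP by (auto elim: open_prod_elim)
  then obtain e where e: "e > 0" "ball y e \<subseteq> B" using open_contains_ball by blast
  define g where "g s t = f (of_real s + t *\<^sub>R I)" for s t
  have sub: "A \<times> ball y e \<subseteq> P" using AB e by blast
  have "((\<lambda>(s, t). g s t) has_derivative
      (\<lambda>(s, t). s *\<^sub>R fx (x, y) + blinfun_apply (blinfun_scaleR_left (fy (x, y))) t))
      (at (x, y) within A \<times> ball y e)"
  proof (rule has_derivative_partialsI)
    show "((\<lambda>s. g s y) has_derivative (\<lambda>s. s *\<^sub>R fx (x, y))) (at x within A)"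
      using d[OF xyP] unfolding g_def has_vector_derivative_def
      by (blast intro: has_derivative_at_withinI)
    show "((\<lambda>t. g s t) has_derivative blinfun_apply (blinfun_scaleR_left (fy (s, t))))
        (at t within ball y e)" if "s \<in> A" "t \<in> ball y e" for s t
    proof -
      have "((\<lambda>t. f (of_real s + t *\<^sub>R I)) has_vector_derivative fy (s, t)) (at t)"
        using d sub that by blast
      then show ?thesis unfolding g_def has_vector_derivative_def
        by (simp add: has_derivative_at_withinI)
    qed
    have "continuous_on (A \<times> ball y e) (\<lambda>p. blinfun_scaleR_left (fy p))"
      by (intro continuous_intros continuous_on_subset[OF fyc sub])
    then show "continuous (at (x, y) within A \<times> ball y e)
        (\<lambda>(s, t). blinfun_scaleR_left (fy (s, t)))"
      using AB e by (simp add: continuous_on_eq_continuous_within case_prod_eta[of "\<lambda>p. blinfun_scaleR_left (fy p)"])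
  qed (use e in auto)
  moreover have "at (x, y) within A \<times> ball y e = at (x, y)"
    using AB e by (intro at_within_open) (auto simp: open_Times)
  ultimately have "((\<lambda>p. g (fst p) (snd p)) has_derivative
      (\<lambda>p. fst p *\<^sub>R fx (x, y) + snd p *\<^sub>R fy (x, y))) (at (Re z, Im z))"
    by (simp add: case_prod_beta' x_def y_def)
  moreover have "((\<lambda>z. (Re z, Im z)) has_derivative (\<lambda>h. (Re h, Im h))) (at z)"
    by (intro derivative_eq_intros) auto
  ultimately have "((\<lambda>z. g (Re z) (Im z)) has_derivative
      (\<lambda>h. Re h *\<^sub>R fx (x, y) + Im h *\<^sub>R fy (x, y))) (at z)"
    using has_derivative_compose by fastforce
  moreover have "Re h *\<^sub>R fx (x, y) + Im h *\<^sub>R fy (x, y) = slice_point I h * fx (x, y)" for h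
  proof -
    have "fx (x, y) + I * fy (x, y) = 0" using d[OF xyP] by simp
    then have "fx (x, y) = - (I * fy (x, y))" by (simp add: eq_neg_iff_add_eq_0)
    then have "I * fx (x, y) = fy (x, y)" by (simp add: imag_units_square'[OF I])
    then show ?thesis by (simp add: slice_point_def distrib_right of_real_def)
  qed
  ultimately show "\<exists>D. ((\<lambda>z. f (slice_point I z)) has_derivative (\<lambda>h. slice_point I h * D)) (at z)"
    unfolding g_def slice_point_def by auto
qed


section \<open>Stem pairs and the local representation formula\<close>

text \<open>A pair \<open>b\<close>, \<open>c\<close> of quaternion-valued functions satisfying the Cauchy-Riemann equations,
  that is, the real and imaginary part of a holomorphic function with values in the
  complexified quaternions.\<close>

definition stem_pair_on :: "complex set \<Rightarrow> (complex \<Rightarrow> quat) \<Rightarrow> (complex \<Rightarrow> quat) \<Rightarrow> bool" where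
  "stem_pair_on N b c \<longleftrightarrow> (\<forall>z\<in>N. \<exists>B C.
     (b has_derivative (\<lambda>h. Re h *\<^sub>R B - Im h *\<^sub>R C)) (at z) \<and>
     (c has_derivative (\<lambda>h. Re h *\<^sub>R C + Im h *\<^sub>R B)) (at z))"

lemma stem_pair_on_continuous:
  assumes "stem_pair_on N b c"
  shows "continuous_on N b" "continuous_on N c"
  using assms unfolding stem_pair_on_def
  by (meson continuous_at_imp_continuous_on has_derivative_continuous)+

lemma stem_pair_slice_holomorphic:
  assumes I: "I \<in> imag_units" and bc: "stem_pair_on N b c"
  shows "slice_holomorphic_on I N (\<lambda>z. b z + I * c z)"
  unfolding slice_holomorphic_on_def
proof
  fix z assume "z \<in> N"
  then obtain B C where
    "(b has_derivative (\<lambda>h. Re h *\<^sub>R B - Im h *\<^sub>R C)) (at z)"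
    "(c has_derivative (\<lambda>h. Re h *\<^sub>R C + Im h *\<^sub>R B)) (at z)"
    using bc unfolding stem_pair_on_def by meson
  then have "((\<lambda>z. b z + I * c z) has_derivative
      (\<lambda>h. (Re h *\<^sub>R B - Im h *\<^sub>R C) + I * (Re h *\<^sub>R C + Im h *\<^sub>R B))) (at z)"
    by (intro has_derivative_add has_derivative_mult_right)
  moreover have "(Re h *\<^sub>R B - Im h *\<^sub>R C) + I * (Re h *\<^sub>R C + Im h *\<^sub>R B)
      = slice_point I h * (B + I * C)" for h
    by (simp add: slice_point_def algebra_simps imag_units_square'[OF I] of_real_def)
  ultimately show "\<exists>D. ((\<lambda>z. b z + I * c z) has_derivative (\<lambda>h. slice_point I h * D)) (at z)"
    by auto
qed

text \<open>Solving \<open>b + J c = F\<close>, \<open>b + K c = G\<close> for \<open>b\<close> and \<open>c\<close>, with \<open>F\<close> and \<open>G\<close> holomorphic along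
  the slices of \<open>J\<close> and \<open>K\<close>, gives a stem pair. The derivatives are found by solving the same
  system; the key identity is \<open>J (J - K)\<^sup>-\<^sup>1 = - (J - K)\<^sup>-\<^sup>1 K\<close>.\<close>

lemma stem_pair_of_two_slices:
  assumes J: "J \<in> imag_units" and K: "K \<in> imag_units" and JK: "J \<noteq> K"
    and F: "slice_holomorphic_on J N F" and G: "slice_holomorphic_on K N G"
  defines "c \<equiv> \<lambda>z. inverse (J - K) * (F z - G z)"
  defines "b \<equiv> \<lambda>z. F z - J * c z"
  shows "stem_pair_on N b c"
  unfolding stem_pair_on_def
proof
  fix z assume z: "z \<in> N"
  define M where "M = inverse (J - K)"
  have M: "M * (J - K) = 1" "(J - K) * M = 1" using JK by (simp_all add: M_def)
  have "(J - K) * J = - (K * (J - K))"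
    by (simp add: algebra_simps imag_units_square[OF J] imag_units_square[OF K])
  then have "M * ((J - K) * J) * M = - (M * (K * (J - K)) * M)" by simp
  then have "(M * (J - K)) * (J * M) = - ((M * K) * ((J - K) * M))" by (simp only: mult.assoc)
  then have JM: "J * M = - (M * K)" by (simp add: M)
  obtain D E where
    D: "(F has_derivative (\<lambda>h. slice_point J h * D)) (at z)" and
    E: "(G has_derivative (\<lambda>h. slice_point K h * E)) (at z)"
    using F G z unfolding slice_holomorphic_on_def by meson
  define C where "C = M * (D - E)"
  define B where "B = M * (J * D - K * E)"
  have "J * C + B = J * M * (D - E) + M * (J * D - K * E)" by (simp add: B_def C_def mult.assoc)
  also have "\<dots> = M * (J - K) * D"
    by (simp add: JM algebra_simps)
  finally have D_eq: "D = J * C + B" by (simp add: M)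
  have c': "(c has_derivative (\<lambda>h. M * (slice_point J h * D - slice_point K h * E))) (at z)"
    unfolding c_def M_def by (intro has_derivative_mult_right has_derivative_diff D E)
  have "M * (slice_point J h * D - slice_point K h * E) = Re h *\<^sub>R C + Im h *\<^sub>R B" for h
    by (simp add: slice_point_def C_def B_def of_real_def algebra_simps)
  with c' have c'': "(c has_derivative (\<lambda>h. Re h *\<^sub>R C + Im h *\<^sub>R B)) (at z)" by simp
  have b': "(b has_derivative (\<lambda>h. slice_point J h * D - J * (Re h *\<^sub>R C + Im h *\<^sub>R B))) (at z)"
    unfolding b_def by (intro has_derivative_mult_right has_derivative_diff D c'')
  have "slice_point J h * D - J * (Re h *\<^sub>R C + Im h *\<^sub>R B) = Re h *\<^sub>R B - Im h *\<^sub>R C" for h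
    by (simp add: D_eq slice_point_def of_real_def algebra_simps imag_units_square'[OF J])
  with b' c'' show "\<exists>B C. (b has_derivative (\<lambda>h. Re h *\<^sub>R B - Im h *\<^sub>R C)) (at z) \<and>
      (c has_derivative (\<lambda>h. Re h *\<^sub>R C + Im h *\<^sub>R B)) (at z)" by auto
qed

text \<open>The representation formula on a family of parallel slice pieces: all of them contain a
  common real point, near which \<open>f\<close> does not depend on the slice, so the identity principle
  propagates \<open>f = b + I c\<close> from two slices to all the others.\<close>

lemma representation_formula:
  assumes f: "slice_regular_on \<Omega> f" and \<Omega>: "open \<Omega>"
    and N: "open N" "connected N" "complex_of_real r \<in> N"
    and V: "\<And>I z. I \<in> imag_units \<inter> V \<Longrightarrow> z \<in> N \<Longrightarrow> slice_point I z \<in> \<Omega>"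
    and J: "J \<in> imag_units \<inter> V" and K: "K \<in> imag_units \<inter> V" and JK: "J \<noteq> K"
  shows "\<exists>b c. stem_pair_on N b c \<and>
    (\<forall>I\<in>imag_units \<inter> V. \<forall>z\<in>N. f (slice_point I z) = b z + I * c z) \<and>
    (\<forall>x. complex_of_real x \<in> N \<longrightarrow> c (of_real x) = 0)"
proof -
  \<comment> \<open>\<open>b\<close> and \<open>c\<close> solve \<open>b + J c = f\<close> on the slice of \<open>J\<close> and \<open>b + K c = f\<close> on the slice of \<open>K\<close>.\<close>
  define c where "c = (\<lambda>z. inverse (J - K) * (f (slice_point J z) - f (slice_point K z)))"
  define b where "b = (\<lambda>z. f (slice_point J z) - J * c z)"
  have hol: "slice_holomorphic_on I N (\<lambda>z. f (slice_point I z))" if "I \<in> imag_units \<inter> V" for I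
    using slice_regular_imp_slice_holomorphic[OF f _ \<Omega>, of I] that V
    by (auto intro: slice_holomorphic_on_subset)
  have stem: "stem_pair_on N b c"
    unfolding b_def c_def using hol J K JK by (intro stem_pair_of_two_slices) auto
  have c0: "c (of_real x) = 0" for x by (simp add: c_def)
  have "f (slice_point I z) = b z + I * c z" if I: "I \<in> imag_units \<inter> V" and z: "z \<in> N" for I z
  proof -
    have "f (slice_point I z) - (b z + I * c z) = 0"
    proof (rule slice_holomorphic_identity[where g = "\<lambda>z. f (slice_point I z) - (b z + I * c z)",
          OF _ _ N open_UNIV UNIV_I _ z])
      show "slice_holomorphic_on I N (\<lambda>z. f (slice_point I z) - (b z + I * c z))"
        using hol[OF I] I stem
        by (intro slice_holomorphic_on_diff stem_pair_slice_holomorphic) auto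
    qed (use I in \<open>auto simp: c0 b_def\<close>)
    then show ?thesis by simp
  qed
  then show ?thesis using stem c0 by blast
qed

text \<open>The pieces of parallel slices through a point: a path in the slice of \<open>I\<close> from the point to
  the real axis is compact, so it has a neighbourhood that stays in \<open>\<Omega>\<close> when \<open>I\<close> is
  slightly rotated.\<close>

lemma slice_domain_tube:
  assumes \<Omega>: "slice_domain \<Omega>" and I: "I \<in> imag_units" and z: "slice_point I z \<in> \<Omega>"
  obtains N V r where "open N" "connected N" "z \<in> N" "complex_of_real r \<in> N" "open V" "I \<in> V"
    "\<And>J w. J \<in> V \<Longrightarrow> w \<in> N \<Longrightarrow> slice_point J w \<in> \<Omega>"
proof -
  have op: "open \<Omega>" and con: "connected (\<Omega> \<inter> slice I)"
    using \<Omega> I by (auto simp: slice_domain_def)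
  obtain r where r: "of_real r \<in> \<Omega>" using \<Omega> by (auto simp: slice_domain_def elim: Reals_cases)
  define P where "P = {z. slice_point I z \<in> \<Omega>}"
  have "open P" "connected P"
    unfolding P_def using op con I open_slice_coordinates connected_slice_coordinates by auto
  then have "path_connected P" by (simp add: connected_open_path_connected)
  moreover have "z \<in> P" "of_real r \<in> P" using z r by (auto simp: P_def)
  ultimately obtain \<gamma> where \<gamma>: "path \<gamma>" "path_image \<gamma> \<subseteq> P" "pathstart \<gamma> = z" "pathfinish \<gamma> = of_real r"
    unfolding path_connected_def by blast
  define W where "W = (\<lambda>(w, J). slice_point J w) -` \<Omega>"
  have "continuous_on UNIV (\<lambda>(w, J). slice_point J w)"
    unfolding case_prod_beta by (intro continuous_intros)
  then have "open W" unfolding W_def by (rule open_vimage[OF op])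
  moreover have "path_image \<gamma> \<times> {I} \<subseteq> W" using \<gamma>(2) by (auto simp: W_def P_def)
  ultimately obtain M V where MV: "open M" "open V" "path_image \<gamma> \<subseteq> M" "I \<in> V" "M \<times> V \<subseteq> W"
    using tube_lemma_left[of euclidean euclidean W "path_image \<gamma>" I] compact_path_image[OF \<gamma>(1)]
    by (auto simp: euclidean_product_topology)
  have zr: "z \<in> path_image \<gamma>" "of_real r \<in> path_image \<gamma>"
    using \<gamma> by (metis pathstart_in_path_image pathfinish_in_path_image)+
  have sub: "path_image \<gamma> \<subseteq> connected_component_set M z"
    using zr MV(3) connected_path_image[OF \<gamma>(1)] by (simp add: connected_component_maximal)
  show ?thesis
  proof
    show "open (connected_component_set M z)" using MV(1) by (rule open_connected_component)
    show "slice_point J w \<in> \<Omega>" if "J \<in> V" "w \<in> connected_component_set M z" for J w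
      using MV(5) that connected_component_subset by (fastforce simp: W_def)
  qed (use MV zr sub in auto)
qed

section \<open>Values attained on spheres\<close>

text \<open>The symmetrization of \<open>b + I c - w\<close>: the complex number
  \<open>\<Sum>\<^sub>k (b\<^sub>k - w\<^sub>k + \<i> c\<^sub>k)\<^sup>2\<close>, where \<open>k\<close> runs over the four real coordinates. For \<open>c \<noteq> 0\<close> it vanishes
  iff \<open>w = b + I c\<close> for an imaginary unit \<open>I\<close>.\<close>

definition sphere_norm :: "quat \<Rightarrow> quat \<Rightarrow> quat \<Rightarrow> complex" where
  "sphere_norm b c w = Complex ((b - w) \<bullet> (b - w) - c \<bullet> c) (2 * ((b - w) \<bullet> c))"

lemma sphere_norm_eq_0:
  assumes "I \<in> imag_units"
  shows "sphere_norm b c (b + I * c) = 0"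
proof -
  have "(I * c) \<bullet> (I * c) = c \<bullet> c"
    using inner_imag_unit_left[OF assms, of c "I * c"] by (simp add: imag_units_square'[OF assms])
  moreover have "(I * c) \<bullet> c = 0" using assms by (simp add: inner_mult_right_quat imag_units_iff)
  ultimately show ?thesis by (simp add: sphere_norm_def complex_eq_iff)
qed

lemma sphere_norm_eq_0_imp:
  assumes "sphere_norm b c w = 0" "c \<noteq> 0"
  defines "I \<equiv> (w - b) * inverse c"
  shows "I \<in> imag_units" "w = b + I * c"
proof -
  have Ic: "I * c = w - b" using assms(2) by (simp add: I_def mult.assoc)
  then show "w = b + I * c" by simp
  have e: "(w - b) \<bullet> (w - b) = c \<bullet> c" "(w - b) \<bullet> c = 0"
    using assms(1) by (simp_all add: sphere_norm_def complex_eq_iff inner_diff algebra_simps)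
  have "qre I * (c \<bullet> c) = 0" using e(2) inner_mult_right_quat[of I c] by (simp add: Ic)
  then have re: "qre I = 0" using assms(2) by simp
  have "norm (w - b) = norm c" using e(1) by (simp add: norm_eq_sqrt_inner)
  then have "norm I = 1" using assms(2) by (simp add: I_def norm_mult norm_inverse)
  then have "(norm I)\<^sup>2 = 1" by simp
  then show "I \<in> imag_units" using re by (simp add: imag_units_iff norm_quat_def)
qed

lemma sphere_norm_holomorphic:
  assumes "stem_pair_on N b c"
  shows "(\<lambda>z. sphere_norm (b z) (c z) w) holomorphic_on N"
  unfolding holomorphic_on_def
proof
  fix z assume "z \<in> N"
  then obtain B C where
    d: "(b has_derivative (\<lambda>h. Re h *\<^sub>R B - Im h *\<^sub>R C)) (at z)"
    "(c has_derivative (\<lambda>h. Re h *\<^sub>R C + Im h *\<^sub>R B)) (at z)"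
    using assms unfolding stem_pair_on_def by meson
  define D where "D = Complex (2 * ((b z - w) \<bullet> B - c z \<bullet> C)) (2 * ((b z - w) \<bullet> C + c z \<bullet> B))"
  have eq: "sphere_norm p q w
      = of_real ((p - w) \<bullet> (p - w) - q \<bullet> q) + \<i> * of_real (2 * ((p - w) \<bullet> q))" for p q
    by (simp add: sphere_norm_def complex_eq_iff)
  have "((\<lambda>z. sphere_norm (b z) (c z) w) has_derivative (\<lambda>h. D * h)) (at z)"
    unfolding eq
    by (rule derivative_eq_intros d refl)+
      (auto simp: fun_eq_iff D_def complex_eq_iff inner_diff inner_add algebra_simps inner_commute)
  then have "((\<lambda>z. sphere_norm (b z) (c z) w) has_field_derivative D) (at z)"
    by (simp add: has_field_derivative_def)
  then show "(\<lambda>z. sphere_norm (b z) (c z) w) field_differentiable (at z within N)"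
    by (meson field_differentiable_at_within field_differentiable_def)
qed

lemma sphere_norm_perturb:
  "cmod (sphere_norm b c w - sphere_norm b c w0)
     \<le> norm (w - w0) * (2 * norm (b - w0) + 2 * norm c + norm (w - w0))"
proof -
  define d where "d = w - w0"
  have e: "sphere_norm b c w - sphere_norm b c w0
      = Complex (d \<bullet> d - 2 * (d \<bullet> (b - w0))) (- 2 * (d \<bullet> c))"
    by (simp add: sphere_norm_def complex_eq_iff d_def inner_diff inner_commute algebra_simps)
  have "cmod (sphere_norm b c w - sphere_norm b c w0)
      \<le> \<bar>d \<bullet> d - 2 * (d \<bullet> (b - w0))\<bar> + \<bar>2 * (d \<bullet> c)\<bar>"
    unfolding e using cmod_le[of "Complex (d \<bullet> d - 2 * (d \<bullet> (b - w0))) (- 2 * (d \<bullet> c))"] by simp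
  also have "\<dots> \<le> norm d * norm d + 2 * (norm d * norm (b - w0)) + 2 * (norm d * norm c)"
    using Cauchy_Schwarz_ineq2[of d d] Cauchy_Schwarz_ineq2[of d "b - w0"]
      Cauchy_Schwarz_ineq2[of d c] by linarith
  finally show ?thesis by (simp add: d_def algebra_simps)
qed

text \<open>Hurwitz' theorem for the symmetrization: an isolated zero persists when \<open>w\<close> is perturbed.\<close>

lemma sphere_norm_zero_persists:
  assumes bc: "stem_pair_on N b c" and N: "open N" "connected N" "z0 \<in> N"
    and zero: "sphere_norm (b z0) (c z0) w0 = 0"
    and nz: "z1 \<in> N" "sphere_norm (b z1) (c z1) w0 \<noteq> 0"
    and e: "e > 0"
  obtains \<delta> where "\<delta> > 0"
    "\<And>w. dist w w0 < \<delta> \<Longrightarrow> \<exists>z\<in>N. dist z z0 < e \<and> sphere_norm (b z) (c z) w = 0"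
proof -
  define \<phi> where "\<phi> w z = sphere_norm (b z) (c z) w" for w z
  have hol: "\<phi> w holomorphic_on N" for w
    unfolding \<phi>_def by (rule sphere_norm_holomorphic[OF bc])
  obtain r0 where r0: "r0 > 0" "ball z0 r0 \<subseteq> N" "\<And>z. z \<in> ball z0 r0 - {z0} \<Longrightarrow> \<phi> w0 z \<noteq> 0"
    using isolated_zeros[OF hol N, of w0 z1] nz zero by (auto simp: \<phi>_def)
  \<comment> \<open>On the circle of radius \<open>r\<close> the symmetrization for \<open>w\<^sub>0\<close> has modulus at least \<open>m > 0\<close>; \<open>\<delta>\<close> is
    chosen so that the symmetrizations for \<open>w\<close> and \<open>w\<^sub>0\<close> differ by less than \<open>m / 2\<close> on the disc.
    The value for \<open>w\<close> at the centre is then smaller than on the circle, which forces a zero.\<close>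
  define r where "r = min r0 e / 2"
  have r: "r > 0" "r < r0" "r < e" using r0(1) e by (auto simp: r_def)
  have cball: "cball z0 r \<subseteq> N" using r r0(2) by auto
  have cont: "continuous_on (cball z0 r) b" "continuous_on (cball z0 r) c"
    using stem_pair_on_continuous[OF bc] cball continuous_on_subset by blast+
  have cont\<phi>: "continuous_on (cball z0 r) (\<phi> w)" for w
    using hol cball continuous_on_subset holomorphic_on_imp_continuous_on by blast
  have ne: "sphere z0 r \<noteq> {}" using r(1) by simp
  have "continuous_on (sphere z0 r) (\<lambda>z. cmod (\<phi> w0 z))"
    by (intro continuous_on_norm continuous_on_subset[OF cont\<phi>]) auto
  then obtain zm where zm: "zm \<in> sphere z0 r" "\<And>z. z \<in> sphere z0 r \<Longrightarrow> cmod (\<phi> w0 zm) \<le> cmod (\<phi> w0 z)"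
    using continuous_attains_inf[OF compact_sphere ne] by blast
  define m where "m = cmod (\<phi> w0 zm)"
  have "\<phi> w0 zm \<noteq> 0" by (rule r0(3)) (use zm(1) r in auto)
  then have m: "m > 0" by (simp add: m_def)
  define g where "g z = 2 * norm (b z - w0) + 2 * norm (c z)" for z
  have "continuous_on (cball z0 r) g" unfolding g_def by (intro continuous_intros cont)
  then obtain zM where zM: "\<And>z. z \<in> cball z0 r \<Longrightarrow> g z \<le> g zM"
    using continuous_attains_sup[OF compact_cball, of z0 r g] r(1) by fastforce
  define B where "B = g zM + 1"
  have B: "B > 0" by (simp add: B_def g_def add_nonneg_pos)
  define \<delta> where "\<delta> = min 1 (m / (2 * B))"
  have \<delta>: "\<delta> > 0" using m B by (simp add: \<delta>_def)
  have "\<exists>z\<in>N. dist z z0 < e \<and> sphere_norm (b z) (c z) w = 0" if w: "dist w w0 < \<delta>" for w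
  proof -
    have close: "cmod (\<phi> w z - \<phi> w0 z) < m / 2" if z: "z \<in> cball z0 r" for z
    proof -
      have nw: "norm (w - w0) < 1" "norm (w - w0) < m / (2 * B)"
        using w by (auto simp: \<delta>_def dist_norm)
      have "cmod (\<phi> w z - \<phi> w0 z) \<le> norm (w - w0) * (g z + norm (w - w0))"
        unfolding \<phi>_def g_def by (rule sphere_norm_perturb)
      also have "\<dots> \<le> norm (w - w0) * B"
        using nw zM[OF z] by (intro mult_left_mono) (auto simp: B_def)
      also have "\<dots> < m / (2 * B) * B" using nw(2) B by (rule mult_strict_right_mono)
      finally show ?thesis using B by simp
    qed
    have "cmod (\<phi> w z0) < cmod (\<phi> w z)" if z: "cmod (z0 - z) = r" for z
    proof -
      have "z \<in> sphere z0 r" using z by (simp add: dist_norm)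
      then have "m \<le> cmod (\<phi> w0 z)" "cmod (\<phi> w z - \<phi> w0 z) < m / 2"
        using zm(2) close by (auto simp: m_def)
      moreover have "cmod (\<phi> w0 z) \<le> cmod (\<phi> w z) + cmod (\<phi> w z - \<phi> w0 z)"
        by (metis norm_minus_commute norm_triangle_sub)
      moreover have "cmod (\<phi> w z0) < m / 2"
        using close[of z0] r(1) zero by (simp add: \<phi>_def)
      ultimately show ?thesis by linarith
    qed
    then obtain z where "z \<in> ball z0 r" "\<phi> w z = 0"
      using holomorphic_contract_to_zero[OF cont\<phi> holomorphic_on_subset[OF hol] r(1)] cball
        ball_subset_cball by (metis order_trans)
    moreover have "z \<in> N" using calculation(1) cball by (simp add: subset_iff)
    ultimately show ?thesis using r by (intro bexI[of _ z]) (auto simp: \<phi>_def dist_commute)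
  qed
  then show ?thesis using that \<delta> by blast
qed


section \<open>The degenerate set\<close>

lemma spherical_coeffsE:
  assumes "spherical_coeffs \<Omega> f x y I b c" "I \<in> imag_units"
  obtains T where "open T" "of_real x + y *\<^sub>R I \<in> T"
    "\<And>J. J \<in> imag_units \<Longrightarrow> of_real x + y *\<^sub>R J \<in> T \<Longrightarrow> f (of_real x + y *\<^sub>R J) = b + J * c"
proof -
  obtain U where U: "openin (top_of_set (sphere_through x y)) U" "of_real x + y *\<^sub>R I \<in> U"
    and fU: "\<And>J. J \<in> imag_units \<Longrightarrow> of_real x + y *\<^sub>R J \<in> U \<Longrightarrow> f (of_real x + y *\<^sub>R J) = b + J * c"
    using assms(1) unfolding spherical_coeffs_def by blast
  obtain T where T: "open T" "U = sphere_through x y \<inter> T"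
    using U(1) unfolding openin_open by blast
  have "of_real x + y *\<^sub>R J \<in> sphere_through x y" if "J \<in> imag_units" for J
    using that unfolding sphere_through_def by blast
  then show ?thesis using that T U(2) fU by simp
qed

lemma spherical_coeffs_unique:
  assumes y: "y > 0" and I: "I \<in> imag_units"
    and 1: "spherical_coeffs \<Omega> f x y I b c" and 2: "spherical_coeffs \<Omega> f x y I b' c'"
  shows "c = c'"
proof -
  obtain T where T: "open T" "of_real x + y *\<^sub>R I \<in> T"
    and f1: "\<And>J. J \<in> imag_units \<Longrightarrow> of_real x + y *\<^sub>R J \<in> T \<Longrightarrow> f (of_real x + y *\<^sub>R J) = b + J * c"
    using spherical_coeffsE[OF 1 I] by blast
  obtain T' where T': "open T'" "of_real x + y *\<^sub>R I \<in> T'"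
    and f2: "\<And>J. J \<in> imag_units \<Longrightarrow> of_real x + y *\<^sub>R J \<in> T' \<Longrightarrow> f (of_real x + y *\<^sub>R J) = b' + J * c'"
    using spherical_coeffsE[OF 2 I] by blast
  define V where "V = (\<lambda>J. of_real x + y *\<^sub>R J) -` (T \<inter> T')"
  have "continuous_on UNIV (\<lambda>J::quat. of_real x + y *\<^sub>R J)" by (intro continuous_intros)
  then have "open V" unfolding V_def using T T' by (intro open_vimage) auto
  moreover have "I \<in> V" using T T' by (simp add: V_def)
  ultimately obtain J where J: "J \<in> imag_units" "J \<in> V" "J \<noteq> I"
    using imag_units_no_isolated[OF I] by blast
  have "b + I * c = b' + I * c'" using f1[OF I] f2[OF I] T T' by simp
  moreover have "b + J * c = b' + J * c'" using f1[OF J(1)] f2[OF J(1)] J(2) by (simp add: V_def)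
  moreover have "(J - I) * (c - c')
      = ((b + J * c) - (b + I * c)) - ((b' + J * c') - (b' + I * c'))"
    by (simp add: algebra_simps)
  ultimately have "(J - I) * (c - c') = 0" by simp
  then show ?thesis using J(3) by simp
qed

lemma spherical_deriv_eq:
  assumes y: "y > 0" and I: "I \<in> imag_units" and bc: "spherical_coeffs \<Omega> f x y I b c"
  shows "spherical_deriv \<Omega> f (of_real x + y *\<^sub>R I) = c /\<^sub>R y"
  unfolding spherical_deriv_def
proof (rule the_equality)
  show "\<exists>x' y' I' b c'. y' > 0 \<and> I' \<in> imag_units \<and> of_real x + y *\<^sub>R I = of_real x' + y' *\<^sub>R I' \<and>
      spherical_coeffs \<Omega> f x' y' I' b c' \<and> c /\<^sub>R y = c' /\<^sub>R y'"
    using assms by blast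
next
  fix d
  assume "\<exists>x' y' I' b c. y' > 0 \<and> I' \<in> imag_units \<and> of_real x + y *\<^sub>R I = of_real x' + y' *\<^sub>R I' \<and>
      spherical_coeffs \<Omega> f x' y' I' b c \<and> d = c /\<^sub>R y'"
  then obtain x' y' I' b' c' where a: "y' > 0" "I' \<in> imag_units"
    "of_real x + y *\<^sub>R I = of_real x' + y' *\<^sub>R I'" "spherical_coeffs \<Omega> f x' y' I' b' c'" "d = c' /\<^sub>R y'"
    by blast
  have "Complex x y = Complex x' y' \<and> I = I'"
    using a y by (intro imag_units_slice_point_unique I) (simp_all add: slice_point_def)
  then show "d = c /\<^sub>R y" using spherical_coeffs_unique[OF y I bc] a by auto
qed

lemma degenerate_set_iff_upper:
  assumes I: "I \<in> imag_units" and V: "open V" "I \<in> V" and z: "Im z > 0"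
    and rep: "\<And>J. J \<in> imag_units \<inter> V \<Longrightarrow> slice_point J z \<in> \<Omega> \<and> f (slice_point J z) = b + J * c"
  shows "slice_point I z \<in> degenerate_set \<Omega> f \<longleftrightarrow> c = 0"
proof -
  define T where "T = (\<lambda>p. (p - of_real (Re z)) /\<^sub>R Im z) -` V"
  have "continuous_on UNIV (\<lambda>p::quat. (p - of_real (Re z)) /\<^sub>R Im z)" by (intro continuous_intros)
  then have T: "open T" unfolding T_def by (rule open_vimage[OF V(1)])
  have T_iff: "of_real (Re z) + Im z *\<^sub>R J \<in> T \<longleftrightarrow> J \<in> V" for J using z by (simp add: T_def)
  have "spherical_coeffs \<Omega> f (Re z) (Im z) I b c"
    unfolding spherical_coeffs_def
  proof (intro exI[of _ "sphere_through (Re z) (Im z) \<inter> T"] conjI ballI impI)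
    show "openin (top_of_set (sphere_through (Re z) (Im z))) (sphere_through (Re z) (Im z) \<inter> T)"
      using T by (rule openin_open_Int)
    show "of_real (Re z) + Im z *\<^sub>R I \<in> sphere_through (Re z) (Im z) \<inter> T"
      using I V(2) by (auto simp: T_iff sphere_through_def)
    show "sphere_through (Re z) (Im z) \<inter> T \<subseteq> \<Omega>"
    proof
      fix p assume p: "p \<in> sphere_through (Re z) (Im z) \<inter> T"
      then obtain J where J: "J \<in> imag_units" "p = of_real (Re z) + Im z *\<^sub>R J"
        unfolding sphere_through_def by blast
      then have "J \<in> V" using p T_iff by simp
      then show "p \<in> \<Omega>" using rep J by (simp add: slice_point_def)
    qed
    show "f (of_real (Re z) + Im z *\<^sub>R J) = b + J * c"
      if "J \<in> imag_units" "of_real (Re z) + Im z *\<^sub>R J \<in> sphere_through (Re z) (Im z) \<inter> T" for J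
    proof -
      have "J \<in> V" using that(2) T_iff by simp
      then show ?thesis using rep[of J] that(1) by (simp add: slice_point_def)
    qed
  qed
  then have "spherical_deriv \<Omega> f (slice_point I z) = c /\<^sub>R Im z"
    unfolding slice_point_def by (rule spherical_deriv_eq[OF z I])
  moreover have "slice_point I z \<in> \<Omega> - \<real>"
    using rep[of I] I V(2) z by (simp add: slice_point_in_Reals_iff)
  ultimately show ?thesis using z by (simp add: degenerate_set_def)
qed

text \<open>A point of the lower half plane of the slice of \<open>I\<close> is a point of the upper half plane of the
  slice of \<open>- I\<close>; this replaces \<open>c\<close> by \<open>- c\<close>.\<close>

lemma degenerate_set_iff:
  assumes I: "I \<in> imag_units" and V: "open V" "I \<in> V" and z: "Im z \<noteq> 0"
    and rep: "\<And>J. J \<in> imag_units \<inter> V \<Longrightarrow> slice_point J z \<in> \<Omega> \<and> f (slice_point J z) = b + J * c"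
  shows "slice_point I z \<in> degenerate_set \<Omega> f \<longleftrightarrow> c = 0"
proof (cases "Im z > 0")
  case True
  then show ?thesis by (rule degenerate_set_iff_upper[OF I V _ rep])
next
  case False
  have "slice_point (- I) (cnj z) \<in> degenerate_set \<Omega> f \<longleftrightarrow> - c = 0"
  proof (rule degenerate_set_iff_upper)
    show "- I \<in> imag_units" using I by (rule uminus_imag_units)
    show "open (uminus ` V)" using V(1) by (rule open_negations)
    show "- I \<in> uminus ` V" using V(2) by blast
    show "Im (cnj z) > 0" using False z by simp
    show "slice_point J (cnj z) \<in> \<Omega> \<and> f (slice_point J (cnj z)) = b + J * - c"
      if "J \<in> imag_units \<inter> uminus ` V" for J
    proof -
      have "- J \<in> imag_units \<inter> V" using that uminus_imag_units[of J] by auto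
      then show ?thesis using rep[of "- J"] by (simp add: slice_point_minus)
    qed
  qed
  then show ?thesis by (simp add: slice_point_minus)
qed

section \<open>Openness off the closure of the degenerate set\<close>

text \<open>If the symmetrization vanished identically, \<open>f\<close> would be constant near a real point of
  \<open>N\<close>, since there \<open>c = 0\<close> and the symmetrization is \<open>\<bar>b - w\<bar>\<^sup>2\<close>; hence constant on every slice.\<close>

lemma sphere_norm_not_identically_0:
  assumes \<Omega>: "slice_domain \<Omega>" and f: "slice_regular_on \<Omega> f" "\<not> f constant_on \<Omega>"
    and N: "open N" "complex_of_real r \<in> N"
    and J: "J \<in> imag_units" "\<And>z. z \<in> N \<Longrightarrow> slice_point J z \<in> \<Omega>"
    and rep: "\<And>z. z \<in> N \<Longrightarrow> f (slice_point J z) = b z + J * c z"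
    and c: "\<And>x. complex_of_real x \<in> N \<Longrightarrow> c (of_real x) = 0"
  obtains z where "z \<in> N" "sphere_norm (b z) (c z) w \<noteq> 0"
proof -
  have "\<exists>z\<in>N. sphere_norm (b z) (c z) w \<noteq> 0"
  proof (rule ccontr)
    assume "\<not> ?thesis"
    then have 0: "sphere_norm (b z) (c z) w = 0" if "z \<in> N" for z using that by blast
    have fx: "f (of_real x) = w" if x: "complex_of_real x \<in> N" for x
      using 0[OF x] rep[OF x] c[OF x] by (simp add: sphere_norm_def complex_eq_iff)
    have "f q = w" if q: "q \<in> \<Omega>" for q
    proof -
      obtain I z where I: "I \<in> imag_units" and qz: "q = slice_point I z"
        by (rule quat_slice_point_cases)
      have op: "open \<Omega>" and con: "connected (\<Omega> \<inter> slice I)"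
        using \<Omega> I by (auto simp: slice_domain_def)
      have "f (slice_point I z) - w = 0"
      proof (rule slice_holomorphic_identity[OF I, where g = "\<lambda>z. f (slice_point I z) - w"])
        show "slice_holomorphic_on I {z. slice_point I z \<in> \<Omega>} (\<lambda>z. f (slice_point I z) - w)"
          by (intro slice_holomorphic_on_diff slice_holomorphic_on_const
              slice_regular_imp_slice_holomorphic f I op)
        show "open {z. slice_point I z \<in> \<Omega>}" using op by (rule open_slice_coordinates)
        show "connected {z. slice_point I z \<in> \<Omega>}" using I con by (rule connected_slice_coordinates)
        show "complex_of_real r \<in> {z. slice_point I z \<in> \<Omega>}" using J(2)[OF N(2)] by simp
        show "z \<in> {z. slice_point I z \<in> \<Omega>}" using q qz by simp
      qed (use N fx in auto)
      then show ?thesis by (simp add: qz)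
    qed
    then show False using f(2) by (auto simp: constant_on_def)
  qed
  then show ?thesis using that by blast
qed

text \<open>At a non-real point \<open>c \<noteq> 0\<close>, and a zero \<open>z\<close> of the symmetrization near \<open>z\<^sub>0\<close> determines the
  imaginary unit \<open>(w - b) c\<^sup>-\<^sup>1\<close>, which depends continuously on \<open>z\<close> and \<open>w\<close> and so stays close
  to \<open>I\<close>.\<close>

lemma locally_open_at_nonreal:
  assumes \<Omega>: "slice_domain \<Omega>" and f: "slice_regular_on \<Omega> f" "\<not> f constant_on \<Omega>"
    and U: "open U" "U \<subseteq> \<Omega> - degenerate_set \<Omega> f"
    and I: "I \<in> imag_units" and z0: "Im z0 \<noteq> 0" "slice_point I z0 \<in> U"
  obtains \<delta> where "\<delta> > 0" "ball (f (slice_point I z0)) \<delta> \<subseteq> f ` U"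
proof -
  have op: "open \<Omega>" using \<Omega> by (simp add: slice_domain_def)
  have z0\<Omega>: "slice_point I z0 \<in> \<Omega>" using z0 U by blast
  obtain N V r where N: "open N" "connected N" "z0 \<in> N" "complex_of_real r \<in> N"
    and V: "open V" "I \<in> V" and NV: "\<And>J w. J \<in> V \<Longrightarrow> w \<in> N \<Longrightarrow> slice_point J w \<in> \<Omega>"
    by (rule slice_domain_tube[OF \<Omega> I z0\<Omega>]) blast
  obtain K where K: "K \<in> imag_units" "K \<in> V" "K \<noteq> I"
    using imag_units_no_isolated[OF I V] by blast
  have NV': "slice_point J z \<in> \<Omega>" if "J \<in> imag_units \<inter> V" "z \<in> N" for J z
    using that NV by blast
  have IV: "I \<in> imag_units \<inter> V" "K \<in> imag_units \<inter> V" using I V(2) K by auto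
  obtain b c where bc: "stem_pair_on N b c"
    and rep: "\<And>J z. J \<in> imag_units \<inter> V \<Longrightarrow> z \<in> N \<Longrightarrow> f (slice_point J z) = b z + J * c z"
    and c_real: "\<And>x. complex_of_real x \<in> N \<Longrightarrow> c (of_real x) = 0"
    using representation_formula[OF f(1) op N(1,2,4) NV' IV(2,1) K(3)] by blast
  have "slice_point J z0 \<in> \<Omega> \<and> f (slice_point J z0) = b z0 + J * c z0"
    if "J \<in> imag_units \<inter> V" for J
    using rep[OF that N(3)] NV[OF _ N(3), of J] that by simp
  then have "slice_point I z0 \<in> degenerate_set \<Omega> f \<longleftrightarrow> c z0 = 0"
    by (rule degenerate_set_iff[OF I V z0(1)])
  then have cz0: "c z0 \<noteq> 0" using z0(2) U(2) by blast
  define w0 where "w0 = f (slice_point I z0)"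
  have w0: "w0 = b z0 + I * c z0" unfolding w0_def using rep[of I z0] I V(2) N(3) by simp
  obtain z1 where z1: "z1 \<in> N" "sphere_norm (b z1) (c z1) w0 \<noteq> 0"
    using sphere_norm_not_identically_0[OF \<Omega> f N(1,4) I NV[OF V(2)] rep[OF IV(1)] c_real] by blast
  note cont = stem_pair_on_continuous[OF bc]
  define M where "M = N \<inter> c -` (- {0})"
  have M: "open M" unfolding M_def using cont(2) N(1) by (intro continuous_open_preimage) auto
  define H where "H p = (snd p - b (fst p)) * inverse (c (fst p))" for p
  define S where "S = (M \<times> UNIV) \<inter> (\<lambda>p. (H p, slice_point (H p) (fst p))) -` (V \<times> U)"
  have cM: "continuous_on (M \<times> UNIV) (\<lambda>p::complex \<times> quat. b (fst p))"
    "continuous_on (M \<times> UNIV) (\<lambda>p::complex \<times> quat. c (fst p))"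
    by (auto intro!: continuous_on_compose2[OF cont(1)] continuous_on_compose2[OF cont(2)]
        continuous_on_fst continuous_on_id simp: M_def)
  have "continuous_on (M \<times> UNIV) H"
    unfolding H_def by (intro continuous_intros cM) (auto simp: M_def)
  then have "continuous_on (M \<times> UNIV) (\<lambda>p. (H p, slice_point (H p) (fst p)))"
    by (intro continuous_intros)
  then have "open S"
    unfolding S_def using M V(1) U(1) by (intro continuous_open_preimage open_Times) auto
  moreover have "(z0, w0) \<in> S"
  proof -
    have "H (z0, w0) = I" using cz0 by (simp add: H_def w0 mult.assoc)
    then show ?thesis using cz0 N(3) V(2) z0(2) by (simp add: S_def M_def)
  qed
  ultimately obtain A B where AB: "open A" "open B" "z0 \<in> A" "w0 \<in> B" "A \<times> B \<subseteq> S"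
    by (auto elim: open_prod_elim)
  obtain e where e: "e > 0" "ball z0 e \<subseteq> A" using AB open_contains_ball by blast
  obtain \<delta>1 where \<delta>1: "\<delta>1 > 0" "ball w0 \<delta>1 \<subseteq> B" using AB open_contains_ball by blast
  have "sphere_norm (b z0) (c z0) w0 = 0" unfolding w0 using I by (rule sphere_norm_eq_0)
  then obtain \<delta>2 where \<delta>2: "\<delta>2 > 0"
    "\<And>w. dist w w0 < \<delta>2 \<Longrightarrow> \<exists>z\<in>N. dist z z0 < e \<and> sphere_norm (b z) (c z) w = 0"
    using sphere_norm_zero_persists[OF bc N(1-3) _ z1 e(1)] by blast
  have "w \<in> f ` U" if w: "w \<in> ball w0 (min \<delta>1 \<delta>2)" for w
  proof -
    obtain z where z: "z \<in> N" "dist z z0 < e" "sphere_norm (b z) (c z) w = 0"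
      using \<delta>2(2)[of w] w by (metis dist_commute mem_ball min_less_iff_conj)
    have "(z, w) \<in> S" using AB(5) e(2) \<delta>1(2) z(2) w by (auto simp: dist_commute subset_iff)
    then have 1: "c z \<noteq> 0" "H (z, w) \<in> V" "slice_point (H (z, w)) z \<in> U"
      by (auto simp: S_def M_def)
    have 2: "H (z, w) \<in> imag_units" "w = b z + H (z, w) * c z"
      using sphere_norm_eq_0_imp[OF z(3) 1(1)] by (simp_all add: H_def)
    have "f (slice_point (H (z, w)) z) = w" using rep[of "H (z, w)" z] 1 2 z(1) by simp
    then show ?thesis using 1(3) by (metis imageI)
  qed
  then have "ball w0 (min \<delta>1 \<delta>2) \<subseteq> f ` U" by blast
  moreover have "min \<delta>1 \<delta>2 > 0" using \<delta>1(1) \<delta>2(1) by simp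
  ultimately show ?thesis using that unfolding w0_def by blast
qed

text \<open>Around a real point the representation formula holds on full spheres, so every imaginary
  unit is admissible; a zero of the symmetrization is either non-real, where \<open>c \<noteq> 0\<close>, or real,
  where \<open>c = 0\<close> and \<open>b = w\<close>.\<close>

lemma locally_open_at_real:
  assumes \<Omega>: "slice_domain \<Omega>" and f: "slice_regular_on \<Omega> f" "\<not> f constant_on \<Omega>"
    and U: "open U" "U \<subseteq> \<Omega> - degenerate_set \<Omega> f"
    and r: "of_real r \<in> U"
  obtains \<delta> where "\<delta> > 0" "ball (f (of_real r)) \<delta> \<subseteq> f ` U"
proof -
  have op: "open \<Omega>" using \<Omega> by (simp add: slice_domain_def)
  obtain e where e: "e > 0" "ball (of_real r) e \<subseteq> U" using U r open_contains_ball by blast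
  define N where "N = ball (complex_of_real r) e"
  have N: "open N" "connected N" "complex_of_real r \<in> N" using e by (auto simp: N_def)
  have NU: "slice_point I z \<in> U" if "I \<in> imag_units" "z \<in> N" for I z
  proof -
    have "dist (slice_point I z) (of_real r) = dist z (of_real r)"
      using norm_slice_point[OF that(1), of "z - of_real r"] by (simp add: dist_norm slice_point_diff)
    then show ?thesis using that(2) e(2) by (auto simp: N_def dist_commute subset_iff)
  qed
  then have N\<Omega>: "slice_point I z \<in> \<Omega>" if "I \<in> imag_units" "z \<in> N" for I z using that U by blast
  obtain J where J: "J \<in> imag_units" using imag_units_nonempty by blast
  obtain K where K: "K \<in> imag_units" "K \<noteq> J" using imag_units_no_isolated[OF J open_UNIV] by blast
  obtain b c where bc: "stem_pair_on N b c"
    and rep: "\<And>I z. I \<in> imag_units \<Longrightarrow> z \<in> N \<Longrightarrow> f (slice_point I z) = b z + I * c z"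
    and c_real: "\<And>x. complex_of_real x \<in> N \<Longrightarrow> c (of_real x) = 0"
    using representation_formula[OF f(1) op N, of UNIV K J] N\<Omega> J K by auto
  have b_real: "f (of_real x) = b (of_real x)" if "complex_of_real x \<in> N" for x
    using rep[OF J that] c_real[OF that] by simp
  define w0 where "w0 = f (of_real r)"
  obtain z1 where z1: "z1 \<in> N" "sphere_norm (b z1) (c z1) w0 \<noteq> 0"
    using sphere_norm_not_identically_0[OF \<Omega> f N(1,3) J N\<Omega>[OF J] rep[OF J] c_real] by blast
  have "sphere_norm (b (of_real r)) (c (of_real r)) w0 = 0"
    using b_real[OF N(3)] c_real[OF N(3)] by (simp add: w0_def sphere_norm_def complex_eq_iff)
  then obtain \<delta> where \<delta>: "\<delta> > 0"
    "\<And>w. dist w w0 < \<delta> \<Longrightarrow> \<exists>z\<in>N. dist z (of_real r) < e \<and> sphere_norm (b z) (c z) w = 0"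
    using sphere_norm_zero_persists[OF bc N _ z1 e(1)] by blast
  have "w \<in> f ` U" if w: "w \<in> ball w0 \<delta>" for w
  proof -
    obtain z where z: "z \<in> N" "sphere_norm (b z) (c z) w = 0"
      using \<delta>(2)[of w] w by (metis dist_commute mem_ball)
    show ?thesis
    proof (cases "Im z = 0")
      case True
      then obtain x where x: "z = of_real x" by (metis complex_is_Real_iff Reals_cases)
      have "f (of_real x) = w"
        using z b_real c_real by (simp add: x sphere_norm_def complex_eq_iff)
      moreover have "of_real x \<in> U" using NU[OF J z(1)] by (simp add: x)
      ultimately show ?thesis by blast
    next
      case False
      have "slice_point I z \<in> \<Omega> \<and> f (slice_point I z) = b z + I * c z"
        if "I \<in> imag_units \<inter> UNIV" for I
        using rep[OF _ z(1), of I] N\<Omega>[OF _ z(1), of I] that by simp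
      then have "slice_point J z \<in> degenerate_set \<Omega> f \<longleftrightarrow> c z = 0"
        by (rule degenerate_set_iff[OF J open_UNIV UNIV_I False])
      then have "c z \<noteq> 0" using NU[OF J z(1)] U(2) by blast
      then obtain I where I: "I \<in> imag_units" "w = b z + I * c z"
        using sphere_norm_eq_0_imp[OF z(2)] by blast
      then show ?thesis using rep[OF I(1) z(1)] NU[OF I(1) z(1)] by (metis imageI)
    qed
  qed
  then have "ball w0 \<delta> \<subseteq> f ` U" by blast
  then show ?thesis using that \<delta>(1) unfolding w0_def by blast
qed

text \<open>The closure of the degenerate set in \<open>\<Omega>\<close> is the trace on \<open>\<Omega>\<close> of its closure in the whole
  space, so its complement in \<open>\<Omega>\<close> is open in the space of quaternions.\<close>

theorem theorem10p5:
  fixes \<Omega> :: "quat set" and f :: "quat \<Rightarrow> quat"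
  assumes "slice_domain \<Omega>"
    and "slice_regular_on \<Omega> f"
    and "\<not> f constant_on \<Omega>"
  shows "open_map
           (top_of_set (\<Omega> - (top_of_set \<Omega> closure_of degenerate_set \<Omega> f)))
           euclidean f"
  unfolding open_map_def
proof (intro allI impI)
  define D where "D = degenerate_set \<Omega> f"
  have D: "D \<subseteq> \<Omega>" by (auto simp: D_def degenerate_set_def)
  fix U assume "openin (top_of_set (\<Omega> - (top_of_set \<Omega> closure_of degenerate_set \<Omega> f))) U"
  then have oin: "openin (top_of_set (\<Omega> - closure D)) U"
    using D by (simp add: closure_of_subtopology Int_absorb1 Diff_Int flip: D_def)
  have "open (\<Omega> - closure D)" using assms(1) by (simp add: slice_domain_def open_Diff)
  then have U: "open U" "U \<subseteq> \<Omega> - closure D"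
    using oin openin_open_trans openin_imp_subset by blast+
  then have UD: "U \<subseteq> \<Omega> - degenerate_set \<Omega> f" using closure_subset[of D] by (auto simp: D_def)
  have "\<exists>\<delta>>0. ball (f p) \<delta> \<subseteq> f ` U" if p: "p \<in> U" for p
  proof -
    obtain I z where I: "I \<in> imag_units" and pz: "p = slice_point I z"
      by (rule quat_slice_point_cases)
    show ?thesis
    proof (cases "Im z = 0")
      case True
      then have "p = of_real (Re z)" using pz by (simp add: slice_point_eq_real)
      then show ?thesis using locally_open_at_real[OF assms U(1) UD] p by metis
    next
      case False
      then show ?thesis using locally_open_at_nonreal[OF assms U(1) UD I] p pz by metis
    qed
  qed
  then have "open (f ` U)" unfolding open_contains_ball by blast
  then show "openin euclidean (f ` U)" by simp
qed

end
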